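(* Assume $\kappa=\kappa^{<\kappa}$. For every $x\in S_\kappa$, the Stone–Čech remainder $(S_\kappa\setminus\{x\})^*$ has cardinality $2^{2^\kappa}$.
   Context: A space is zero-dimensional if it has a base of clopen sets. For a zero-dimensional space $X$ and an open $U\subseteq X$, the ($X$-)type $\tau(U)$ is the least cardinal $\tau$ such that $U$ is a union of $\tau$ many clopen subsets of $X$. A zero-dimensional space is an $F_\kappa$-space if every open subset of type less than $\kappa$ is $C^*$-embedded (every bounded continuous real-valued function on it extends continuously to the whole space). A space is a $G_\kappa$-space if every non-empty intersection of fewer than $\kappa$ open sets has non-empty interior. A $\kappa$-Parovičenko space is a compact Hausdorff zero-dimensional $F_\kappa$- and $G_\kappa$-space without isolated points (no weight restriction is imposed). If $\kappa=\kappa^{<\kappa}$ there is, up to homeomorphism, a unique $\kappa$-Parovičenko space of weight $\kappa$; it is denoted $S_\kappa$. For a Tychonoff space $X$, $X^*=\beta X\setminus X$. *)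

theory Defs
  imports "HOL-Analysis.Analysis"
begin

unbundle cardinal_syntax

text \<open>Cardinals are represented by sets: the cardinal kappa is the cardinality of a set K.\<close>

text \<open>kappa = kappa^(<kappa), where kappa^(<kappa) = sup of kappa^lambda over lambda < kappa.
  (kappa^(<kappa) is at least kappa always, via lambda = 1, for infinite kappa.)\<close>
definition kappa_eq_kappa_less_kappa :: "'k set \<Rightarrow> bool" where
  "kappa_eq_kappa_less_kappa K \<longleftrightarrow>
     (\<forall>L. L \<subseteq> K \<and> (card_of L) <o (card_of K) \<longrightarrow> (card_of (Func L K)) \<le>o (card_of K))"

definition clopenin :: "'a topology \<Rightarrow> 'a set \<Rightarrow> bool" where
  "clopenin X C \<longleftrightarrow> openin X C \<and> closedin X C"

definition is_base :: "'a topology \<Rightarrow> 'a set set \<Rightarrow> bool" where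
  "is_base X \<B> \<longleftrightarrow> (\<forall>B\<in>\<B>. openin X B) \<and>
     (\<forall>U. openin X U \<longrightarrow> (\<exists>\<C>\<subseteq>\<B>. \<Union>\<C> = U))"

definition zero_dimensional :: "'a topology \<Rightarrow> bool" where
  "zero_dimensional X \<longleftrightarrow> (\<exists>\<B>. is_base X \<B> \<and> (\<forall>B\<in>\<B>. clopenin X B))"

definition weight_eq :: "'a topology \<Rightarrow> 'k set \<Rightarrow> bool" where
  "weight_eq X K \<longleftrightarrow> (\<exists>\<B>. is_base X \<B> \<and> (card_of \<B>) =o (card_of K)) \<and>
     (\<forall>\<B>. is_base X \<B> \<longrightarrow> (card_of K) \<le>o (card_of \<B>))"

definition type_less :: "'a topology \<Rightarrow> 'a set \<Rightarrow> 'k set \<Rightarrow> bool" where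
  "type_less X U K \<longleftrightarrow> (\<exists>\<C>. (\<forall>C\<in>\<C>. clopenin X C) \<and> \<Union>\<C> = U \<and> (card_of \<C>) <o (card_of K))"

definition C_star_embedded :: "'a topology \<Rightarrow> 'a set \<Rightarrow> bool" where
  "C_star_embedded X U \<longleftrightarrow>
     (\<forall>f. continuous_map (subtopology X U) euclideanreal f \<and> bounded (f ` U) \<longrightarrow>
        (\<exists>g. continuous_map X euclideanreal g \<and> (\<forall>x\<in>U. g x = f x)))"

definition F_kappa_space :: "'k set \<Rightarrow> 'a topology \<Rightarrow> bool" where
  "F_kappa_space K X \<longleftrightarrow> zero_dimensional X \<and>
     (\<forall>U. openin X U \<and> type_less X U K \<longrightarrow> C_star_embedded X U)"

definition G_kappa_space :: "'k set \<Rightarrow> 'a topology \<Rightarrow> bool" where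
  "G_kappa_space K X \<longleftrightarrow>
     (\<forall>\<U>. (\<forall>U\<in>\<U>. openin X U) \<and> (card_of \<U>) <o (card_of K) \<and> topspace X \<inter> \<Inter>\<U> \<noteq> {} \<longrightarrow>
        X interior_of (topspace X \<inter> \<Inter>\<U>) \<noteq> {})"

definition kappa_Parovicenko :: "'k set \<Rightarrow> 'a topology \<Rightarrow> bool" where
  "kappa_Parovicenko K X \<longleftrightarrow> compact_space X \<and> Hausdorff_space X \<and> zero_dimensional X \<and>
     F_kappa_space K X \<and> G_kappa_space K X \<and> (\<forall>x\<in>topspace X. \<not> openin X {x})"

definition stone_cech :: "'a topology \<Rightarrow> 'b topology \<Rightarrow> ('a \<Rightarrow> 'b) \<Rightarrow> bool" where
  "stone_cech X Y e \<longleftrightarrow> compact_space Y \<and> Hausdorff_space Y \<and> embedding_map X Y e \<and>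
     Y closure_of (e ` topspace X) = topspace Y \<and>
     (\<forall>f. continuous_map X euclideanreal f \<and> bounded (f ` topspace X) \<longrightarrow>
        (\<exists>g. continuous_map Y euclideanreal g \<and> (\<forall>x\<in>topspace X. g (e x) = f x)))"

end

theory Submission
  imports Defs "HOL-Algebra.Free_Abelian_Groups" (* for card_of_Fpow_infinite *)
begin

text \<open>
  The upper bound holds because \<open>S - {x}\<close> has a dense subset of size at most \<open>\<kappa>\<close>. For the lower bound,
  cover \<open>S - {x}\<close> by clopen sets \<open>C\<^sub>k\<close> (\<open>k < \<kappa>\<close>). By the \<open>G\<^sub>\<kappa>\<close> property and since \<open>x\<close> is not isolated,
  for \<open>\<kappa>\<close> many \<open>k\<close> there is a non-empty clopen \<open>D\<^sub>k \<subseteq> C\<^sub>k\<close> missing all earlier \<open>C\<^sub>j\<close>. By transfinite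
  recursion and the \<open>F\<^sub>\<kappa>\<close> property, every set \<open>A\<close> of indices is realised by a clopen \<open>V\<close> of
  \<open>S - {x}\<close> that contains \<open>D\<^sub>k\<close> for \<open>k \<in> A\<close> and misses \<open>D\<^sub>k\<close> for \<open>k \<notin> A\<close>. Realising an independent
  family of \<open>2\<^sup>\<kappa>\<close> index sets gives clopen sets that are independent modulo finite unions of the \<open>C\<^sub>k\<close>;
  each choice of sides yields a point of the remainder, and different choices yield different
  points, since complementary clopen sets have disjoint closures in the compactification.
\<close>

section \<open>Clopen sets, separation and extension of characteristic functions\<close>

lemma clopenin_Int: "clopenin X A \<Longrightarrow> clopenin X B \<Longrightarrow> clopenin X (A \<inter> B)"
  and clopenin_Un: "clopenin X A \<Longrightarrow> clopenin X B \<Longrightarrow> clopenin X (A \<union> B)"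
  and clopenin_Diff: "clopenin X A \<Longrightarrow> clopenin X B \<Longrightarrow> clopenin X (A - B)"
  unfolding clopenin_def by auto

lemma clopenin_empty: "clopenin X {}"
  unfolding clopenin_def by auto

lemma zero_dimensional_point:
  assumes "zero_dimensional X" "openin X U" "z \<in> U"
  obtains C where "clopenin X C" "z \<in> C" "C \<subseteq> U"
proof -
  obtain \<B> where B: "is_base X \<B>" "\<forall>B\<in>\<B>. clopenin X B"
    using assms unfolding zero_dimensional_def by auto
  obtain \<C> where "\<C> \<subseteq> \<B>" "\<Union>\<C> = U"
    using B assms unfolding is_base_def by metis
  with B assms that show ?thesis by blast
qed

text \<open>The closed set is compact, so finitely many of the clopen subsets of \<open>B\<close>
  already cover it.\<close>

lemma clopen_between:
  assumes "compact_space X" "zero_dimensional X" "closedin X A" "openin X B" "A \<subseteq> B"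
  obtains W where "clopenin X W" "A \<subseteq> W" "W \<subseteq> B"
proof -
  let ?\<C> = "{C. clopenin X C \<and> C \<subseteq> B}"
  have "compactin X A"
    using assms closedin_compact_space by blast
  moreover have "A \<subseteq> \<Union>?\<C>"
  proof
    fix z assume "z \<in> A"
    then obtain C where "clopenin X C" "z \<in> C" "C \<subseteq> B"
      using zero_dimensional_point[OF assms(2,4)] assms(5) by blast
    then show "z \<in> \<Union>?\<C>" by blast
  qed
  ultimately obtain \<F> where F: "finite \<F>" "\<F> \<subseteq> ?\<C>" "A \<subseteq> \<Union>\<F>"
    using compactinD[of X A ?\<C>] unfolding clopenin_def by blast
  have "clopenin X (\<Union>\<F>)"
    using F unfolding clopenin_def by (auto intro: closedin_Union)
  with F that show ?thesis by blast
qed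

lemma continuous_map_clopen_char:
  assumes "clopenin X V"
  shows "continuous_map X euclideanreal (\<lambda>x. if x \<in> V then 1 else 0)"
  unfolding continuous_map_def
proof (intro conjI allI impI)
  fix U :: "real set"
  have "{x \<in> topspace X. (if x \<in> V then 1 else 0) \<in> U} =
     (if 1 \<in> U then V else {}) \<union> (if 0 \<in> U then topspace X - V else {})"
    using openin_subset[of X V] assms unfolding clopenin_def by auto
  then show "openin X {x \<in> topspace X. (if x \<in> V then 1 else 0) \<in> U}"
    using assms unfolding clopenin_def by auto
qed auto

lemma bounded_char: "bounded ((\<lambda>x. if x \<in> V then 1 else (0::real)) ` A)"
  by (rule bounded_subset[of "{0,1}"]) auto

lemma C_star_embeddedD:
  assumes "C_star_embedded X U" "continuous_map (subtopology X U) euclideanreal f" "bounded (f ` U)"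
  shows "\<exists>g. continuous_map X euclideanreal g \<and> (\<forall>x\<in>U. g x = f x)"
  using assms unfolding C_star_embedded_def by blast

text \<open>The characteristic function of \<open>P\<close> is continuous on
  \<open>P \<union> Q\<close>, since both pieces are open. The \<open>F_kappa\<close> property
  extends it to the whole space, and compactness turns the extension into a clopen set.\<close>

lemma F_kappa_separation:
  assumes "compact_space X" "F_kappa_space K X" "openin X P" "openin X Q" "P \<inter> Q = {}"
    "type_less X (P \<union> Q) K"
  obtains W where "clopenin X W" "P \<subseteq> W" "W \<inter> Q = {}"
proof -
  let ?f = "\<lambda>x. if x \<in> P then 1 else (0::real)"
  have "C_star_embedded X (P \<union> Q)"
    using assms unfolding F_kappa_space_def by blast
  moreover have "clopenin (subtopology X (P \<union> Q)) P"
  proof -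
    have "openin (subtopology X (P \<union> Q)) P" "openin (subtopology X (P \<union> Q)) Q"
      using assms by (simp_all add: openin_open_subtopology openin_Un)
    moreover have "P = topspace (subtopology X (P \<union> Q)) - Q"
      using assms openin_subset[of X P] openin_subset[of X Q] by auto
    ultimately show ?thesis
      unfolding clopenin_def by (metis closedin_diff closedin_topspace)
  qed
  ultimately obtain g where g: "continuous_map X euclideanreal g" "\<forall>x\<in>P \<union> Q. g x = ?f x"
    using C_star_embeddedD[OF _ continuous_map_clopen_char bounded_char] by metis
  \<comment> \<open>The extension is 1 on \<open>P\<close> and 0 on \<open>Q\<close>, so a clopen
    set squeezed between \<open>{g \<ge> 1}\<close> and \<open>{g > 0}\<close> separates
    them.\<close>
  let ?A = "{x \<in> topspace X. g x \<in> {1..}}" and ?B = "{x \<in> topspace X. g x \<in> {0<..}}"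
  have "closedin X ?A"
    by (rule closedin_continuous_map_preimage[OF g(1)]) auto
  moreover have "openin X ?B"
    by (rule openin_continuous_map_preimage[OF g(1)]) auto
  moreover have "?A \<subseteq> ?B" by auto
  moreover have "zero_dimensional X"
    using assms unfolding F_kappa_space_def by auto
  ultimately obtain W where W: "clopenin X W" "?A \<subseteq> W" "W \<subseteq> ?B"
    using clopen_between assms(1) by blast
  have "P \<subseteq> ?A" using g(2) openin_subset[OF assms(3)] by auto
  moreover have "g z = 0" if "z \<in> Q" for z using g(2) assms(5) that by auto
  then have "?B \<inter> Q = {}" by auto
  ultimately show ?thesis using W that by blast
qed

text \<open>The characteristic function of \<open>V\<close> extends to \<open>Y\<close>; by
  continuity the extension is 1 on one closure and 0 on the other.\<close>

lemma stone_cech_clopen_closures_disjoint: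
  assumes "stone_cech X Y e" "clopenin X V"
  shows "Y closure_of (e ` V) \<inter> Y closure_of (e ` (topspace X - V)) = {}"
proof -
  let ?f = "\<lambda>x. if x \<in> V then 1 else (0::real)"
  obtain g where g: "continuous_map Y euclideanreal g" "\<forall>x\<in>topspace X. g (e x) = ?f x"
    using assms(1) continuous_map_clopen_char[OF assms(2)] bounded_char
    unfolding stone_cech_def by blast
  have e: "e ` topspace X \<subseteq> topspace Y"
    using assms unfolding stone_cech_def
    by (meson continuous_map_image_subset_topspace embedding_map_def homeomorphic_imp_continuous_map continuous_map_into_fulltopology)
  have V: "V \<subseteq> topspace X"
    using assms openin_subset unfolding clopenin_def by auto
  have "Y closure_of (e ` V) \<subseteq> {y \<in> topspace Y. g y \<in> {1}}"
    by (rule closure_of_minimal[OF _ closedin_continuous_map_preimage[OF g(1)]])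
      (use g e V in auto)
  moreover have "Y closure_of (e ` (topspace X - V)) \<subseteq> {y \<in> topspace Y. g y \<in> {0}}"
    by (rule closure_of_minimal[OF _ closedin_continuous_map_preimage[OF g(1)]])
      (use g e V in auto)
  ultimately show ?thesis by fastforce
qed

section \<open>Covering the punctured space by clopen sets\<close>

lemma clopen_cover_of_punctured_space:
  assumes "zero_dimensional X" "Hausdorff_space X" "is_base X \<B>" "card_of \<B> =o card_of K"
    "x \<in> topspace X"
  obtains C where "\<And>k. clopenin X (C k)" "(\<Union>k\<in>K. C k) = topspace X - {x}"
proof -
  obtain b where b: "bij_betw b K \<B>"
    using assms(4) card_of_ordIso ordIso_symmetric by blast
  define good where "good B C \<longleftrightarrow> clopenin X C \<and> x \<notin> C \<and> B \<subseteq> C" for B C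
  \<comment> \<open>Members of the base may fail to be clopen, so each one is enlarged to a clopen
    set missing \<open>x\<close> whenever this is possible. The default \<open>{}\<close> keeps
    \<open>C k\<close> clopen for every \<open>k\<close>.\<close>
  define C where "C k = (if \<exists>D. good (b k) D then SOME D. good (b k) D else {})" for k
  have C: "good (b k) (C k)" if "\<exists>D. good (b k) D" for k
    using someI_ex[OF that] that unfolding C_def by auto
  have cl: "clopenin X (C k)" and nx: "x \<notin> C k" for k
    using C[of k] clopenin_empty unfolding good_def by (metis C_def empty_iff good_def)+
  have "z \<in> (\<Union>k\<in>K. C k)" if z: "z \<in> topspace X - {x}" for z
  proof -
    obtain U where "openin X U" "z \<in> U" "x \<notin> U"
      using assms(2,5) z unfolding Hausdorff_space_def disjnt_def by blast
    then obtain D where D: "clopenin X D" "z \<in> D" "x \<notin> D"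
      using zero_dimensional_point[OF assms(1)] by blast
    then obtain \<D> where "\<D> \<subseteq> \<B>" "\<Union>\<D> = D"
      using assms(3) unfolding is_base_def clopenin_def by metis
    then obtain B where B: "B \<in> \<B>" "z \<in> B" "B \<subseteq> D" using D by blast
    then obtain k where "k \<in> K" "b k = B" using b unfolding bij_betw_def by blast
    moreover have "good B D" using B D unfolding good_def by auto
    ultimately show ?thesis using C[of k] B(2) unfolding good_def by blast
  qed
  moreover have "C k \<subseteq> topspace X - {x}" for k
    using cl[of k] nx[of k] openin_subset unfolding clopenin_def by blast
  ultimately show ?thesis using cl that by blast
qed

section \<open>Independent families of index sets\<close>

text \<open>The set \<open>M\<close> of forbidden indices makes the family independent modulo small
  sets. It will absorb the indices whose cells may meet a given finite union of the
  \<open>C k\<close>.\<close>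

lemma independent_family:
  assumes "infinite K" "card_of L =o card_of K"
  obtains A :: "'k set \<Rightarrow> 'l set" where
    "\<And>\<F> \<G> M. finite \<F> \<Longrightarrow> finite \<G> \<Longrightarrow> \<F> \<subseteq> Pow K \<Longrightarrow> \<G> \<subseteq> Pow K \<Longrightarrow> \<F> \<inter> \<G> = {} \<Longrightarrow>
      card_of M <o card_of K \<Longrightarrow>
      \<exists>l\<in>L - M. (\<forall>U\<in>\<F>. l \<in> A U) \<and> (\<forall>U\<in>\<G>. l \<notin> A U)"
proof -
  let ?T = "Fpow K \<times> Fpow (Fpow K)"
  have FK: "card_of (Fpow K) =o card_of K"
    using card_of_Fpow_infinite assms(1) by blast
  have "infinite (Fpow K)"
    using FK assms(1) card_of_ordIso_finite by blast
  then have "card_of ?T =o card_of (Fpow K)"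
    using card_of_Times_infinite[of "Fpow K" "Fpow (Fpow K)"] card_of_Fpow_infinite[of "Fpow K"]
      Fpow_not_empty[of "Fpow K"] ordIso_imp_ordLeq by blast
  then have "card_of ?T =o card_of K"
    using FK ordIso_transitive by blast
  then have "card_of L =o card_of ?T"
    using assms(2) ordIso_symmetric ordIso_transitive by blast
  then obtain h where h: "bij_betw h L ?T"
    using card_of_ordIso by blast
  text \<open>Hausdorff's family: index by pairs of a finite set and a finite set of its traces.\<close>
  define A where "A U = {l \<in> L. fst (h l) \<inter> U \<in> snd (h l)}" for U
  show ?thesis
  proof (rule that[of A])
    fix \<F> \<G> :: "'k set set" and M :: "'l set"
    assume fin: "finite \<F>" "finite \<G>" and sub: "\<F> \<subseteq> Pow K" "\<G> \<subseteq> Pow K"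
      and dis: "\<F> \<inter> \<G> = {}" and M: "card_of M <o card_of K"
    have "\<exists>k\<in>K. (k \<in> fst p) \<noteq> (k \<in> snd p)" if "p \<in> \<F> \<times> \<G>" for p
    proof -
      have "fst p \<in> \<F>" "snd p \<in> \<G>" using that by auto
      then have "fst p \<noteq> snd p" "fst p \<subseteq> K" "snd p \<subseteq> K" using sub dis by auto
      then show ?thesis by blast
    qed
    then obtain d where d: "\<forall>p\<in>\<F> \<times> \<G>. d p \<in> K \<and> (d p \<in> fst p) \<noteq> (d p \<in> snd p)"
      by metis
    define E where "E = d ` (\<F> \<times> \<G>)"
    have E: "finite E" "E \<subseteq> K" using fin d unfolding E_def by auto
    \<comment> \<open>The finite set \<open>E\<close> separates each member of \<open>\<F>\<close>
      from each member of \<open>\<G>\<close>. Adding a varying point \<open>k\<close> preserves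
      this and yields as many different codes as \<open>K\<close> has elements.\<close>
    define t where "t k = (insert k E, (\<lambda>U. insert k E \<inter> U) ` \<F>)" for k
    have t: "t k \<in> ?T" if "k \<in> K" for k
      using that E fin unfolding t_def Fpow_def by auto
    define l where "l k = inv_into L h (t k)" for k
    have hl: "h (l k) = t k" "l k \<in> L" if "k \<in> K" for k
      using t[OF that] h unfolding l_def
      by (auto simp: bij_betw_def f_inv_into_f inv_into_into)
    have "inj_on l (K - E)"
    proof (rule inj_onI)
      fix k k' assume k: "k \<in> K - E" "k' \<in> K - E" "l k = l k'"
      then have "t k = t k'" using hl by (metis DiffD1)
      then have "insert k E = insert k' E" unfolding t_def by simp
      then show "k = k'" using k by blast
    qed
    moreover have "card_of (K - E) =o card_of K"
      using E assms(1) by (simp add: card_of_infinite_diff_finite)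
    \<comment> \<open>The injective image of \<open>K - E\<close> has the cardinality of
      \<open>K\<close>, which is too large to fit into \<open>M\<close>.\<close>
    ultimately have "\<not> l ` (K - E) \<subseteq> M"
      using M by (metis card_of_ordLeq not_ordLess_ordIso ordLeq_ordLess_trans ordIso_symmetric)
    then obtain k where k: "k \<in> K" "k \<notin> E" "l k \<notin> M" by blast
    have "l k \<in> A U" if "U \<in> \<F>" for U
      using that hl[OF k(1)] unfolding A_def t_def by auto
    \<comment> \<open>The trace of \<open>V\<close> on \<open>insert k E\<close> differs from the
      trace of every \<open>U \<in> \<F>\<close>, as witnessed by \<open>d (U,V)\<close>.\<close>
    moreover have "l k \<notin> A V" if "V \<in> \<G>" for V
    proof
      assume "l k \<in> A V"
      then obtain U where U: "U \<in> \<F>" "insert k E \<inter> V = insert k E \<inter> U"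
        using hl[OF k(1)] unfolding A_def t_def by auto
      moreover have "d (U,V) \<in> E" using U that unfolding E_def by auto
      moreover have "(d (U,V) \<in> U) \<noteq> (d (U,V) \<in> V)" using d U that by fastforce
      ultimately show False by blast
    qed
    ultimately show "\<exists>l\<in>L - M. (\<forall>U\<in>\<F>. l \<in> A U) \<and> (\<forall>U\<in>\<G>. l \<notin> A U)"
      using hl(2)[OF k(1)] k(3) by blast
  qed
qed

section \<open>Cardinality bounds from dense sets\<close>

lemma card_of_Hausdorff_le_Pow_Pow_dense:
  assumes "Hausdorff_space Y" "Y closure_of D = topspace Y"
  shows "card_of (topspace Y) \<le>o card_of (Pow (Pow D))"
proof -
  text \<open>A point is determined by the traces of its neighbourhoods on the dense set.\<close>
  let ?T = "\<lambda>y. {D \<inter> U | U. openin Y U \<and> y \<in> U}"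
  have "y = z" if yz: "y \<in> topspace Y" "z \<in> topspace Y" "?T y = ?T z" for y z
  proof (rule ccontr)
    assume "y \<noteq> z"
    then obtain U V where UV: "openin Y U" "openin Y V" "y \<in> U" "z \<in> V" "U \<inter> V = {}"
      using assms(1) yz unfolding Hausdorff_space_def disjnt_def by meson
    then have "D \<inter> U \<in> ?T z" using yz(3) by blast
    then obtain U' where U': "D \<inter> U = D \<inter> U'" "openin Y U'" "z \<in> U'" by blast
    \<comment> \<open>This neighbourhood of \<open>z\<close> misses \<open>D\<close>: inside
      \<open>D\<close>, the set \<open>U'\<close> agrees with \<open>U\<close>, which is disjoint
      from \<open>V\<close>.\<close>
    then have "openin Y (V \<inter> U')" "z \<in> V \<inter> U'" using UV by auto
    then have "D \<inter> (V \<inter> U') \<noteq> {}"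
      using assms(2) yz(2) by (metis in_closure_of IntI empty_iff)
    then show False using U' UV(5) by blast
  qed
  then have "inj_on ?T (topspace Y)" by (intro inj_onI) blast
  then show ?thesis by (rule card_of_ordLeqI) auto
qed

lemma card_of_Pow_Pow_mono:
  assumes "card_of A \<le>o card_of B"
  shows "card_of (Pow (Pow A)) \<le>o card_of (Pow (Pow B))"
proof -
  obtain f where f: "inj_on f A" "f ` A \<subseteq> B"
    using assms unfolding card_of_ordLeq[symmetric] by blast
  have "inj_on ((`) ((`) f)) (Pow (Pow A))"
    by (intro inj_on_image_Pow f)
  then show ?thesis
    by (rule card_of_ordLeqI) (use f in auto)
qed

lemma dense_subset_of_base:
  assumes "is_base X \<B>"
  obtains D where "D \<subseteq> topspace X" "card_of D \<le>o card_of \<B>"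
    "\<And>U. openin X U \<Longrightarrow> U \<noteq> {} \<Longrightarrow> D \<inter> U \<noteq> {}"
proof
  let ?D = "(\<lambda>B. SOME z. z \<in> B) ` (\<B> - {{}})"
  show "?D \<subseteq> topspace X"
  proof
    fix z assume "z \<in> ?D"
    then obtain B where "B \<in> \<B>" "z \<in> B" using some_in_eq by blast
    then show "z \<in> topspace X" using assms openin_subset unfolding is_base_def by blast
  qed
  show "card_of ?D \<le>o card_of \<B>"
    using card_of_image card_of_mono1 ordLeq_transitive by (metis Diff_subset)
  fix U assume "openin X U" "U \<noteq> {}"
  then obtain \<C> where "\<C> \<subseteq> \<B>" "\<Union>\<C> = U"
    using assms unfolding is_base_def by metis
  with \<open>U \<noteq> {}\<close> obtain B where "B \<in> \<B>" "B \<noteq> {}" "B \<subseteq> U" by blast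
  then have "(SOME z. z \<in> B) \<in> ?D \<inter> U"
    using some_in_eq[of B] by blast
  then show "?D \<inter> U \<noteq> {}" by blast
qed

lemma continuous_map_dense_image:
  assumes "continuous_map X Y e" "Y closure_of (e ` topspace X) = topspace Y"
    "X closure_of D = topspace X"
  shows "Y closure_of (e ` D) = topspace Y"
proof
  have "e ` topspace X \<subseteq> Y closure_of (e ` D)"
    using continuous_map_image_closure_subset[OF assms(1), of D] assms(3) by simp
  then show "topspace Y \<subseteq> Y closure_of (e ` D)"
    using assms(2) by (metis closedin_closure_of closure_of_minimal)
qed (rule closure_of_subset_topspace)

section \<open>Cells and the transfinite extension of clopen sets\<close>

lemma card_of_image_underS_ordLess:
  assumes "k \<in> K"
  shows "card_of (f ` underS (card_of K) k) <o card_of K"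
proof -
  have "card_of (underS (card_of K) k) <o card_of K"
    by (rule card_of_underS) (simp_all add: assms Field_card_of)
  then show ?thesis by (rule ordLeq_ordLess_trans[OF card_of_image])
qed

lemma G_kappa_spaceD:
  assumes "G_kappa_space K X" "\<And>U. U \<in> \<U> \<Longrightarrow> openin X U" "card_of \<U> <o card_of K"
    "topspace X \<inter> \<Inter>\<U> \<noteq> {}"
  shows "X interior_of (topspace X \<inter> \<Inter>\<U>) \<noteq> {}"
  using assms unfolding G_kappa_space_def by blast

text \<open>The set \<open>L\<close> consists of the indices whose \<open>C k\<close> is not covered
  by the earlier ones. At such an index the part of \<open>C k\<close> outside the earlier sets has
  non-empty interior by the \<open>G_kappa\<close> property, which leaves room for a clopen
  cell.\<close>

lemma Parovicenko_cells:
  assumes "infinite K" "kappa_Parovicenko K X" "x \<in> topspace X"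
    and C: "\<And>k. clopenin X (C k)" "(\<Union>k\<in>K. C k) = topspace X - {x}"
  obtains L D where "L \<subseteq> K" "card_of L =o card_of K"
    "\<And>k. clopenin X (D k)" "\<And>k. D k \<subseteq> C k"
    "\<And>l. l \<in> L \<Longrightarrow> D l \<noteq> {}"
    "\<And>k j. j \<in> underS (card_of K) k \<Longrightarrow> D k \<inter> C j = {}"
proof -
  let ?r = "card_of K"
  have G: "G_kappa_space K X" and zd: "zero_dimensional X" and ni: "\<not> openin X {x}"
    using assms(2,3) unfolding kappa_Parovicenko_def by auto
  have Csub: "C k \<subseteq> topspace X" for k
    using C(1) openin_subset unfolding clopenin_def by blast
  define L where "L = {k \<in> K. \<not> C k \<subseteq> (\<Union>j\<in>underS ?r k. C j)}"
  \<comment> \<open>The least index whose \<open>C\<close> contains \<open>z\<close> belongs to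
    \<open>L\<close>.\<close>
  have cover: "z \<in> (\<Union>k\<in>L. C k)" if "z \<in> C k" "k \<in> K" for z k
  proof -
    have "wo_rel ?r" by (simp add: card_of_Well_order wo_rel_def)
    then have wf: "wf (?r - Id)" by (simp add: wo_rel.WF)
    have "k \<in> {k \<in> K. z \<in> C k}" using that by simp
    then obtain m where m: "m \<in> {k \<in> K. z \<in> C k}"
      "\<And>j. (j, m) \<in> ?r - Id \<Longrightarrow> j \<notin> {k \<in> K. z \<in> C k}"
      by (rule wfE_min[OF wf]) (rule that)
    have "z \<notin> (\<Union>j\<in>underS ?r m. C j)"
    proof
      assume "z \<in> (\<Union>j\<in>underS ?r m. C j)"
      then obtain j where j: "j \<in> underS ?r m" "z \<in> C j" by blast
      then have "(j, m) \<in> ?r - Id" unfolding underS_def by simp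
      then have "j \<in> K" "j \<notin> {k \<in> K. z \<in> C k}"
        using m(2) Field_card_of[of K] by (auto simp: Field_def)
      with j(2) show False by simp
    qed
    with m(1) show ?thesis unfolding L_def by blast
  qed
  have LK: "L \<subseteq> K" unfolding L_def by blast
  have "card_of L =o ?r"
  proof (rule ccontr)
    assume "\<not> card_of L =o ?r"
    then have less: "card_of L <o ?r"
      using card_of_mono1[OF LK] ordLeq_iff_ordLess_or_ordIso by blast
    text \<open>Otherwise \<open>{x}\<close> would be an intersection of fewer than \<open>\<kappa>\<close> open sets, hence open.\<close>
    let ?\<U> = "(\<lambda>k. topspace X - C k) ` L"
    have "(\<Union>k\<in>L. C k) = topspace X - {x}"
      using C(2) LK cover by blast
    then have eq: "topspace X \<inter> \<Inter>?\<U> = {x}"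
      using assms(3) by blast
    have "X interior_of (topspace X \<inter> \<Inter>?\<U>) \<noteq> {}"
    proof (rule G_kappa_spaceD[OF G])
      show "card_of ?\<U> <o ?r" by (rule ordLeq_ordLess_trans[OF card_of_image less])
      show "openin X U" if "U \<in> ?\<U>" for U
        using that C(1) unfolding clopenin_def by blast
      show "topspace X \<inter> \<Inter>?\<U> \<noteq> {}" using eq by simp
    qed
    then have "X interior_of {x} \<noteq> {}" unfolding eq .
    then show False
      using ni interior_of_subset[of X "{x}"] openin_interior_of[of X "{x}"]
      by (metis subset_singletonD)
  qed
  moreover have "\<exists>D. clopenin X D \<and> D \<noteq> {} \<and> D \<subseteq> C l \<and> (\<forall>j\<in>underS ?r l. D \<inter> C j = {})"
    if l: "l \<in> L" for l
  proof -
    \<comment> \<open>The intersection is \<open>C l\<close> without all earlier \<open>C j\<close>;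
      it is non-empty because \<open>l \<in> L\<close>.\<close>
    let ?\<U> = "{C l} \<union> (\<lambda>j. topspace X - C j) ` underS ?r l"
    have "X interior_of (topspace X \<inter> \<Inter>?\<U>) \<noteq> {}"
    proof (rule G_kappa_spaceD[OF G])
      have "card_of ((\<lambda>j. topspace X - C j) ` underS ?r l) <o ?r"
        by (rule card_of_image_underS_ordLess) (use l LK in blast)
      then show "card_of ?\<U> <o ?r"
        by (rule card_of_Un_singl_ordLess_infinite1[OF assms(1)])
      show "openin X U" if "U \<in> ?\<U>" for U
        using that C(1) unfolding clopenin_def by blast
      show "topspace X \<inter> \<Inter>?\<U> \<noteq> {}"
        using l Csub[of l] unfolding L_def by blast
    qed
    then obtain z where "z \<in> X interior_of (topspace X \<inter> \<Inter>?\<U>)" by blast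
    then obtain D where "clopenin X D" "z \<in> D" "D \<subseteq> X interior_of (topspace X \<inter> \<Inter>?\<U>)"
      using zero_dimensional_point[OF zd openin_interior_of] by metis
    moreover from this(3) have "D \<subseteq> topspace X \<inter> \<Inter>?\<U>"
      using interior_of_subset order_trans by metis
    ultimately show ?thesis by blast
  qed
  then obtain D where D: "\<forall>l\<in>L. clopenin X (D l) \<and> D l \<noteq> {} \<and> D l \<subseteq> C l \<and>
      (\<forall>j\<in>underS ?r l. D l \<inter> C j = {})"
    by metis
  ultimately show ?thesis
    \<comment> \<open>Empty cells off \<open>L\<close> make the clopen, inclusion and disjointness
      properties hold at every index.\<close>
    by (intro that[of L "\<lambda>k. if k \<in> L then D k else {}"]) (use LK clopenin_empty in auto)
qed

text \<open>The traces \<open>f k\<close> of \<open>V\<close> on the sets \<open>C k\<close> are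
  built by recursion along the well-order of \<open>K\<close>. Each new trace must agree with the
  earlier ones on overlaps, while its behaviour on the new cell \<open>D k\<close> is free because
  \<open>D k\<close> misses all earlier \<open>C j\<close>.\<close>

lemma clopen_extension:
  assumes X: "compact_space X" "F_kappa_space K X"
    and C: "\<And>k. clopenin X (C k)" and D: "\<And>k. clopenin X (D k)" "\<And>k. D k \<subseteq> C k"
    "\<And>k j. j \<in> underS (card_of K) k \<Longrightarrow> D k \<inter> C j = {}"
  obtains V where "V \<subseteq> (\<Union>k\<in>K. C k)" "\<And>k. k \<in> K \<Longrightarrow> clopenin X (V \<inter> C k)"
    "\<And>k. k \<in> A \<Longrightarrow> k \<in> K \<Longrightarrow> D k \<subseteq> V" "\<And>k. k \<in> K \<Longrightarrow> k \<notin> A \<Longrightarrow> D k \<inter> V = {}"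
proof -
  let ?r = "card_of K"
  let ?R = "?r - Id"
  have wo: "wo_rel ?r" by (simp add: card_of_Well_order wo_rel_def)
  then have wf: "wf ?R" by (simp add: wo_rel.WF)
  \<comment> \<open>\<open>P f k w\<close> says that \<open>w\<close> is an admissible trace on
    \<open>C k\<close> given the earlier traces \<open>f\<close>. It is vacuous off
    \<open>K\<close>, so the recursion can run over the whole type.\<close>
  define P where "P f k w \<longleftrightarrow> (k \<in> K \<longrightarrow> clopenin X w \<and> w \<subseteq> C k \<and> (k \<in> A \<longrightarrow> D k \<subseteq> w) \<and>
      (k \<notin> A \<longrightarrow> D k \<inter> w = {}) \<and> (\<forall>j. (j, k) \<in> ?R \<longrightarrow> w \<inter> C j = f j \<inter> C k))" for f k w
  have RK: "j \<in> K" if "(j, k) \<in> ?R" for j k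
    using that Field_card_of[of K] by (auto simp: Field_def)
  have "\<exists>f. \<forall>k. P f k (f k)"
  proof (rule dependent_wf_choice[OF wf])
    fix k and f :: "'b \<Rightarrow> 'a set" assume IH: "\<And>j. (j, k) \<in> ?R \<Longrightarrow> P f j (f j)"
    show "\<exists>w. P f k w"
    proof (cases "k \<in> K")
      case True
      let ?U = "underS ?r k"
      have UR: "j \<in> ?U \<longleftrightarrow> (j, k) \<in> ?R" for j unfolding underS_def by auto
      have f: "clopenin X (f j)" "f j \<subseteq> C j" "\<forall>i. (i, j) \<in> ?R \<longrightarrow> f j \<inter> C i = f i \<inter> C j"
        if "j \<in> ?U" for j
        using IH[of j] UR RK that unfolding P_def by blast+
      \<comment> \<open>Agreement with earlier traces becomes symmetric because any two indices are
        comparable.\<close>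
      have coh: "f j \<inter> C i = f i \<inter> C j" if "i \<in> ?U" "j \<in> ?U" for i j
      proof -
        have "i \<in> K" "j \<in> K" using that UR RK by blast+
        then have "i = j \<or> (i, j) \<in> ?R \<or> (j, i) \<in> ?R"
          using wo_rel.TOTALS[OF wo] Field_card_of[of K] by blast
        then show ?thesis using f that by blast
      qed
      \<comment> \<open>The points already put into \<open>V\<close> and those already excluded.
        Coherence makes the two open sets disjoint, and their union is that of fewer than \<kappa>
        clopen sets \<open>C j\<close>, so the \<open>F_kappa\<close> property separates
        them.\<close>
      let ?P = "\<Union>j\<in>?U. f j" and ?Q = "\<Union>j\<in>?U. C j - f j"
      have type: "type_less X (?P \<union> ?Q) K"
        unfolding type_less_def
      proof (intro exI conjI)
        show "\<forall>B\<in>C ` ?U. clopenin X B" using C by blast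
        show "\<Union> (C ` ?U) = ?P \<union> ?Q" using f(2) by blast
        show "card_of (C ` ?U) <o ?r"
          by (rule card_of_image_underS_ordLess[OF True])
      qed
      have op: "openin X ?P" "openin X ?Q"
        using f(1) clopenin_Diff[OF C f(1)] unfolding clopenin_def by blast+
      have "?P \<inter> ?Q = {}"
        using coh f(2) by blast
      then obtain W where W: "clopenin X W" "?P \<subseteq> W" "W \<inter> ?Q = {}"
        by (rule F_kappa_separation[OF X op _ type])
      \<comment> \<open>The separating set is corrected on \<open>D k\<close> alone, which leaves
        its intersection with every earlier \<open>C j\<close> unchanged.\<close>
      define w where "w = (if k \<in> A then (W \<inter> C k) \<union> D k else (W \<inter> C k) - D k)"
      have "clopenin X w"
        unfolding w_def by (simp add: clopenin_Int clopenin_Un clopenin_Diff C D(1) W(1))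
      moreover have "w \<inter> C j = f j \<inter> C k" if "j \<in> ?U" for j
      proof -
        have "f j \<subseteq> W" using W(2) that by blast
        moreover have "W \<inter> (C j - f j) = {}" using W(3) that by blast
        ultimately have "W \<inter> C j = f j" using f(2)[OF that] by blast
        moreover have "w \<inter> C j = W \<inter> C j \<inter> C k"
          using D(3)[OF that] by (auto simp: w_def)
        ultimately show ?thesis by simp
      qed
      ultimately have "P f k w"
        unfolding P_def UR[symmetric] using D(2)[of k] by (simp add: w_def) blast
      then show ?thesis ..
    qed (auto simp: P_def)
  next
    fix f g :: "'b \<Rightarrow> 'a set" and k w assume "\<And>j. (j, k) \<in> ?R \<Longrightarrow> f j = g j"
    then show "P f k w = P g k w" unfolding P_def by auto
  qed
  then obtain f where "\<forall>k. P f k (f k)" ..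
  then have f: "clopenin X (f k)" "f k \<subseteq> C k" "k \<in> A \<Longrightarrow> D k \<subseteq> f k" "k \<notin> A \<Longrightarrow> D k \<inter> f k = {}"
    "\<forall>j. (j, k) \<in> ?R \<longrightarrow> f k \<inter> C j = f j \<inter> C k" if "k \<in> K" for k
    using that unfolding P_def by blast+
  have coh: "f j \<inter> C i = f i \<inter> C j" if "i \<in> K" "j \<in> K" for i j
  proof -
    have "i = j \<or> (i, j) \<in> ?R \<or> (j, i) \<in> ?R"
      using wo_rel.TOTALS[OF wo] Field_card_of[of K] that by blast
    then show ?thesis using f(5) that by blast
  qed
  let ?V = "\<Union>k\<in>K. f k"
  \<comment> \<open>By coherence, the other traces contribute nothing to \<open>C k\<close> beyond
    \<open>f k\<close>.\<close>
  have VC: "?V \<inter> C k = f k" if "k \<in> K" for k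
    using coh f(2) that by blast
  show ?thesis
  proof (rule that[of ?V])
    show "?V \<subseteq> (\<Union>k\<in>K. C k)" using f(2) by blast
    show "clopenin X (?V \<inter> C k)" if "k \<in> K" for k using VC f(1) that by simp
    show "D k \<subseteq> ?V" if "k \<in> A" "k \<in> K" for k using f(3) that by blast
    show "D k \<inter> ?V = {}" if "k \<in> K" "k \<notin> A" for k
      using VC[OF that(1)] f(4)[OF that] D(2)[of k] by blast
  qed
qed

section \<open>The lower bound\<close>

text \<open>A cell \<open>D l\<close> misses \<open>C j\<close> once \<open>l\<close> is strictly
  above \<open>j\<close>. Hence the indices to be avoided for finitely many \<open>C j\<close> lie
  in such a union of initial segments.\<close>

lemma finite_UN_initial_segments_ordLess:
  assumes "infinite K" "finite J" "J \<subseteq> K"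
  shows "card_of (\<Union>j\<in>J. {j} \<union> underS (card_of K) j) <o card_of K"
  using assms(2,3)
proof (induction J)
  case empty
  show ?case using assms(1) by (simp add: finite_ordLess_infinite2)
next
  case (insert j J)
  have "card_of (underS (card_of K) j) <o card_of K"
    using card_of_image_underS_ordLess[of j K "\<lambda>i. i"] insert.prems by simp
  then have "card_of ({j} \<union> underS (card_of K) j) <o card_of K"
    by (rule card_of_Un_singl_ordLess_infinite1[OF assms(1)])
  moreover have "card_of (\<Union>j\<in>J. {j} \<union> underS (card_of K) j) <o card_of K"
    using insert by blast
  ultimately have "card_of (({j} \<union> underS (card_of K) j) \<union> (\<Union>j\<in>J. {j} \<union> underS (card_of K) j)) <o card_of K"
    by (rule card_of_Un_ordLess_infinite[OF assms(1)])
  then show ?case by simp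
qed

text \<open>Both \<open>V\<close> and \<open>S - V\<close> are unions of clopen pieces, one inside
  each \<open>C k\<close>.\<close>

lemma clopenin_subtopology_UN:
  assumes C: "\<And>k. k \<in> K \<Longrightarrow> clopenin X (C k)" "(\<Union>k\<in>K. C k) = S"
    and V: "V \<subseteq> S" "\<And>k. k \<in> K \<Longrightarrow> clopenin X (V \<inter> C k)"
  shows "clopenin (subtopology X S) V"
proof -
  have "openin X (\<Union>k\<in>K. C k)"
    using C(1) unfolding clopenin_def by blast
  then have S: "openin X S" unfolding C(2) .
  have "openin X (\<Union>k\<in>K. V \<inter> C k)"
    using V(2) unfolding clopenin_def by blast
  moreover have "(\<Union>k\<in>K. V \<inter> C k) = V" using V(1) C(2) by blast
  ultimately have "openin X V" by simp
  moreover have "openin X (\<Union>k\<in>K. C k - V \<inter> C k)"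
    using clopenin_Diff[OF C(1) V(2)] unfolding clopenin_def by blast
  moreover have "(\<Union>k\<in>K. C k - V \<inter> C k) = S - V" using C(2) by blast
  ultimately show ?thesis
    using S V(1) openin_subset[OF S]
    by (auto simp: clopenin_def closedin_def openin_open_subtopology Int_absorb1)
qed

text \<open>The injection sends a family \<open>\<E>\<close> of subsets of \<open>K\<close> to a
  point whose position relative to the closures of the sets \<open>V U\<close> records which
  \<open>U\<close> belong to \<open>\<E>\<close>.\<close>

lemma card_of_remainder_ge:
  fixes K :: "'k set"
  assumes K: "infinite K" and P: "kappa_Parovicenko K X" and x: "x \<in> topspace X"
    and C: "\<And>k. clopenin X (C k)" "(\<Union>k\<in>K. C k) = topspace X - {x}"
    and sc: "stone_cech (subtopology X (topspace X - {x})) Y e"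
  shows "card_of (Pow (Pow K)) \<le>o card_of (topspace Y - e ` (topspace X - {x}))"
proof -
  let ?r = "card_of K"
  let ?S = "topspace X - {x}"
  let ?T = "subtopology X ?S"
  have topT: "topspace ?T = ?S" by auto
  have X: "compact_space X" "F_kappa_space K X"
    using P unfolding kappa_Parovicenko_def by auto
  have wo: "wo_rel ?r" by (simp add: card_of_Well_order wo_rel_def)
  obtain L D where LK: "L \<subseteq> K" and L: "card_of L =o card_of K"
    and D: "\<And>k. clopenin X (D k)" "\<And>k. D k \<subseteq> C k" "\<And>l. l \<in> L \<Longrightarrow> D l \<noteq> {}"
      "\<And>k j. j \<in> underS (card_of K) k \<Longrightarrow> D k \<inter> C j = {}"
    by (rule Parovicenko_cells[OF K P x C]) (rule that)
  obtain A :: "'k set \<Rightarrow> 'k set" where A: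
    "\<And>\<F> \<G> M. finite \<F> \<Longrightarrow> finite \<G> \<Longrightarrow> \<F> \<subseteq> Pow K \<Longrightarrow> \<G> \<subseteq> Pow K \<Longrightarrow> \<F> \<inter> \<G> = {} \<Longrightarrow>
      card_of M <o card_of K \<Longrightarrow> \<exists>l\<in>L - M. (\<forall>U\<in>\<F>. l \<in> A U) \<and> (\<forall>U\<in>\<G>. l \<notin> A U)"
    by (rule independent_family[OF K L]) (rule that)
  have "\<exists>V. V \<subseteq> ?S \<and> (\<forall>k\<in>K. clopenin X (V \<inter> C k) \<and> (k \<in> A U \<longrightarrow> D k \<subseteq> V) \<and>
      (k \<notin> A U \<longrightarrow> D k \<inter> V = {}))" for U
  proof -
    obtain V where "V \<subseteq> (\<Union>k\<in>K. C k)" "\<And>k. k \<in> K \<Longrightarrow> clopenin X (V \<inter> C k)"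
      "\<And>k. k \<in> A U \<Longrightarrow> k \<in> K \<Longrightarrow> D k \<subseteq> V" "\<And>k. k \<in> K \<Longrightarrow> k \<notin> A U \<Longrightarrow> D k \<inter> V = {}"
      by (rule clopen_extension[where C = C and D = D and K = K and A = "A U",
          OF X C(1) D(1,2)]) (erule D(4), rule that)
    then show ?thesis unfolding C(2) by (intro exI[of _ V]) simp
  qed
  then obtain V where "\<And>U. V U \<subseteq> ?S \<and> (\<forall>k\<in>K. clopenin X (V U \<inter> C k) \<and>
      (k \<in> A U \<longrightarrow> D k \<subseteq> V U) \<and> (k \<notin> A U \<longrightarrow> D k \<inter> V U = {}))"
    by metis
  then have V: "\<And>U. V U \<subseteq> ?S" "\<And>U k. k \<in> K \<Longrightarrow> clopenin X (V U \<inter> C k)"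
      "\<And>U k. k \<in> K \<Longrightarrow> k \<in> A U \<Longrightarrow> D k \<subseteq> V U" "\<And>U k. k \<in> K \<Longrightarrow> k \<notin> A U \<Longrightarrow> D k \<inter> V U = {}"
    by simp_all
  have CS: "C k \<subseteq> ?S" if "k \<in> K" for k using C(2) that by blast
  have cV: "clopenin ?T (V U)" for U
    by (rule clopenin_subtopology_UN[OF C V(1,2)])
  have cC: "clopenin ?T (C k)" if "k \<in> K" for k
    by (rule clopenin_subtopology_UN[OF C CS[OF that]]) (rule clopenin_Int[OF C(1) C(1)])
  define cl where "cl W = Y closure_of (e ` W)" for W
  have e: "e ` ?S \<subseteq> topspace Y"
    using sc unfolding stone_cech_def embedding_map_def
    by (metis topT homeomorphic_imp_continuous_map continuous_map_into_fulltopology continuous_map_image_subset_topspace)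
  have in_cl: "e z \<in> cl W" if "z \<in> W" "W \<subseteq> ?S" for z W
    unfolding cl_def using closure_of_subset[of "e ` W" Y] that e by blast
  have cl_disj: "cl W \<inter> cl (?S - W) = {}" if "clopenin ?T W" for W
    using stone_cech_clopen_closures_disjoint[OF sc that] unfolding cl_def topT .
  define F where "F \<E> U = (if U \<in> \<E> then V U else ?S - V U)" for \<E> U
  \<comment> \<open>The first closed sets encode \<open>\<E>\<close>; the second ones force a common
    point to lie outside the image of the punctured space.\<close>
  define Z where "Z \<E> = (\<lambda>U. cl (F \<E> U)) ` Pow K \<union> (\<lambda>k. cl (?S - C k)) ` K" for \<E>
  have "\<Inter>(Z \<E>) \<noteq> {}" for \<E>
  proof -
    have "\<Inter>\<F> \<noteq> {}" if \<F>: "finite \<F>" "\<F> \<subseteq> Z \<E>" for \<F>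
    proof -
      obtain \<F>1 \<F>2 where \<F>12: "\<F>1 \<subseteq> (\<lambda>U. cl (F \<E> U)) ` Pow K"
        "\<F>2 \<subseteq> (\<lambda>k. cl (?S - C k)) ` K" "\<F> = \<F>1 \<union> \<F>2"
        using \<F>(2) unfolding Z_def by (rule subset_UnE)
      then have fin: "finite \<F>1" "finite \<F>2" using \<F>(1) by simp_all
      obtain \<G> where \<G>: "\<G> \<subseteq> Pow K" "finite \<G>" "\<F>1 = (\<lambda>U. cl (F \<E> U)) ` \<G>"
        using finite_subset_image[OF fin(1) \<F>12(1)] by blast
      obtain J where J: "J \<subseteq> K" "finite J" "\<F>2 = (\<lambda>k. cl (?S - C k)) ` J"
        using finite_subset_image[OF fin(2) \<F>12(2)] by blast
      \<comment> \<open>An index outside \<open>?M\<close> is strictly above every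
        \<open>j \<in> J\<close>, so its cell misses each of these \<open>C j\<close>. Any point of
        that cell will witness the finite intersection.\<close>
      let ?M = "\<Union>j\<in>J. {j} \<union> underS ?r j"
      have "\<exists>l\<in>L - ?M. (\<forall>U\<in>\<G> \<inter> \<E>. l \<in> A U) \<and> (\<forall>U\<in>\<G> - \<E>. l \<notin> A U)"
      proof (rule A)
        show "card_of ?M <o ?r" by (rule finite_UN_initial_segments_ordLess[OF K J(2,1)])
        show "finite (\<G> \<inter> \<E>)" "finite (\<G> - \<E>)" using \<G>(2) by simp_all
        show "\<G> \<inter> \<E> \<subseteq> Pow K" "\<G> - \<E> \<subseteq> Pow K" using \<G>(1) by blast+
        show "(\<G> \<inter> \<E>) \<inter> (\<G> - \<E>) = {}" by blast
      qed
      then obtain l where "l \<in> L - ?M"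
        and lA: "(\<forall>U\<in>\<G> \<inter> \<E>. l \<in> A U) \<and> (\<forall>U\<in>\<G> - \<E>. l \<notin> A U)" ..
      then have l: "l \<in> L" "l \<notin> ?M" by simp_all
      have lA: "U \<in> \<E> \<longleftrightarrow> l \<in> A U" if "U \<in> \<G>" for U
        using lA that by (cases "U \<in> \<E>") simp_all
      from l have lK: "l \<in> K" using LK by blast
      obtain z where z: "z \<in> D l" using D(3)[OF l(1)] by blast
      then have zS: "z \<in> ?S" using D(2) CS[OF lK] by blast
      have "e z \<in> cl (F \<E> U)" if "U \<in> \<G>" for U
      proof (rule in_cl)
        show "z \<in> F \<E> U"
          using V(3,4)[OF lK, of U] lA[OF that] z zS unfolding F_def by auto
        show "F \<E> U \<subseteq> ?S" using V(1) unfolding F_def by auto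
      qed
      moreover have "e z \<in> cl (?S - C j)" if j: "j \<in> J" for j
      proof (rule in_cl)
        have "j \<in> K" using J(1) j by blast
        then have "(j, l) \<in> ?r \<or> (l, j) \<in> ?r"
          using wo_rel.TOTALS[OF wo] Field_card_of[of K] lK by blast
        moreover have "l \<noteq> j" "l \<notin> underS ?r j" using l(2) j by auto
        ultimately have "j \<in> underS ?r l" unfolding underS_def by auto
        then show "z \<in> ?S - C j" using D(4) z zS by blast
      qed auto
      ultimately have "e z \<in> \<Inter>\<F>" unfolding \<F>12(3) \<G>(3) J(3) by blast
      then show ?thesis by blast
    qed
    moreover have "\<forall>W\<in>Z \<E>. closedin Y W" unfolding Z_def cl_def by auto
    ultimately have "(\<forall>W\<in>Z \<E>. closedin Y W) \<and> (\<forall>\<F>. finite \<F> \<and> \<F> \<subseteq> Z \<E> \<longrightarrow> \<Inter>\<F> \<noteq> {})"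
      by simp
    moreover have "compact_space Y" using sc unfolding stone_cech_def by simp
    ultimately show ?thesis
      by (rule compact_space_fip[THEN iffD1, THEN spec, THEN mp, rotated])
  qed
  then have "\<forall>\<E>. \<exists>y. y \<in> \<Inter>(Z \<E>)" by (simp only: ex_in_conv simp_thms)
  then obtain p where p: "\<And>\<E>. p \<E> \<in> \<Inter>(Z \<E>)" using choice by metis
  have pF: "p \<E> \<in> cl (F \<E> U)" if "U \<in> Pow K" for \<E> U
    using p[of \<E>] that unfolding Z_def by blast
  have pC: "p \<E> \<in> cl (?S - C k)" if "k \<in> K" for \<E> k
    using p[of \<E>] that unfolding Z_def by blast
  have "inj_on p (Pow (Pow K))"
  proof (rule inj_onI, rule ccontr)
    fix \<E> \<E>' assume EE: "\<E> \<in> Pow (Pow K)" "\<E>' \<in> Pow (Pow K)" "p \<E> = p \<E>'" "\<E> \<noteq> \<E>'"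
    from EE(4) obtain U where U: "(U \<in> \<E>) \<noteq> (U \<in> \<E>')" by (auto simp: set_eq_iff)
    then have UK: "U \<in> Pow K" using EE(1,2) by (auto dest: subsetD)
    \<comment> \<open>Exactly one of the two families contains \<open>U\<close>, so the common point
      lies in the closures of both sides of \<open>V U\<close>.\<close>
    have "p \<E> \<in> cl (V U) \<inter> cl (?S - V U)"
      using pF[OF UK, of \<E>] pF[OF UK, of \<E>'] U EE(3)
      by (cases "U \<in> \<E>") (simp_all add: F_def)
    then show False using cl_disj[OF cV] by simp
  qed
  moreover have "p \<E> \<in> topspace Y - e ` ?S" for \<E>
  proof
    have "cl (F \<E> {}) \<subseteq> topspace Y" unfolding cl_def by (rule closure_of_subset_topspace)
    then show "p \<E> \<in> topspace Y" using pF[of "{}" \<E>] by auto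
    show "p \<E> \<notin> e ` ?S"
    proof
      assume "p \<E> \<in> e ` ?S"
      then obtain z where z: "z \<in> ?S" "p \<E> = e z" by blast
      then obtain k where k: "k \<in> K" "z \<in> C k" using C(2) by blast
      have "p \<E> \<in> cl (C k)" unfolding z(2) by (rule in_cl[OF k(2) CS[OF k(1)]])
      with pC[OF k(1)] have "p \<E> \<in> cl (C k) \<inter> cl (?S - C k)" by simp
      then show False using cl_disj[OF cC[OF k(1)]] by simp
    qed
  qed
  ultimately show ?thesis by (rule card_of_ordLeqI)
qed

section \<open>The upper bound and the exact cardinality\<close>

text \<open>A dense set with one point from each non-empty base member remains dense when restricted
  to the open set \<open>S\<close>. Its image under \<open>e\<close> is dense in \<open>Y\<close>,
  and a Hausdorff space has at most as many points as the double power set of a dense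
  subset.\<close>

lemma card_of_stone_cech_le:
  assumes "is_base X \<B>" "card_of \<B> \<le>o card_of K" "openin X S" "stone_cech (subtopology X S) Y e"
  shows "card_of (topspace Y) \<le>o card_of (Pow (Pow K))"
proof -
  obtain D where D: "D \<subseteq> topspace X" "card_of D \<le>o card_of \<B>"
    "\<And>U. openin X U \<Longrightarrow> U \<noteq> {} \<Longrightarrow> D \<inter> U \<noteq> {}"
    by (rule dense_subset_of_base[OF assms(1)]) (rule that)
  let ?T = "subtopology X S"
  have "?T closure_of (D \<inter> S) = topspace ?T"
  proof
    show "topspace ?T \<subseteq> ?T closure_of (D \<inter> S)"
    proof
      fix z assume z: "z \<in> topspace ?T"
      have "\<exists>y. y \<in> D \<inter> S \<and> y \<in> U" if "openin ?T U" "z \<in> U" for U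
      proof -
        have "openin X U" "U \<subseteq> S" using that(1) assms(3) by (auto simp: openin_open_subtopology)
        then show ?thesis using D(3)[of U] that(2) by blast
      qed
      then show "z \<in> ?T closure_of (D \<inter> S)" using z unfolding in_closure_of by blast
    qed
  qed (rule closure_of_subset_topspace)
  moreover have e: "continuous_map ?T Y e" "Y closure_of (e ` topspace ?T) = topspace Y"
    "Hausdorff_space Y"
    using assms(4) homeomorphic_imp_continuous_map continuous_map_into_fulltopology
    unfolding stone_cech_def embedding_map_def by metis+
  ultimately have "Y closure_of (e ` (D \<inter> S)) = topspace Y"
    using continuous_map_dense_image by metis
  then have "card_of (topspace Y) \<le>o card_of (Pow (Pow (e ` (D \<inter> S))))"
    by (rule card_of_Hausdorff_le_Pow_Pow_dense[OF e(3)])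
  moreover have "card_of (e ` (D \<inter> S)) \<le>o card_of D"
    by (rule ordLeq_transitive[OF card_of_image card_of_mono1[OF Int_lower1]])
  then have "card_of (e ` (D \<inter> S)) \<le>o card_of K"
    by (rule ordLeq_transitive[OF _ ordLeq_transitive[OF D(2) assms(2)]])
  ultimately show ?thesis
    by (rule ordLeq_transitive[OF _ card_of_Pow_Pow_mono])
qed

theorem theorem7p4:
  fixes K :: "'k set" and S :: "'a topology" and Y :: "'b topology" and e :: "'a \<Rightarrow> 'b"
  assumes "infinite K"
    and "kappa_eq_kappa_less_kappa K"
    and "kappa_Parovicenko K S"
    and "weight_eq S K"
    and "x \<in> topspace S"
    and "stone_cech (subtopology S (topspace S - {x})) Y e"
  shows "(card_of (topspace Y - e ` (topspace S - {x})), card_of (Pow (Pow K))) \<in> ordIso"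
proof -
  let ?S = "topspace S - {x}"
  have S: "zero_dimensional S" "Hausdorff_space S"
    using assms(3) unfolding kappa_Parovicenko_def by auto
  obtain \<B> where \<B>: "is_base S \<B>" "card_of \<B> =o card_of K"
    using assms(4) unfolding weight_eq_def by blast
  obtain C where C: "\<And>k. clopenin S (C k)" "(\<Union>k\<in>K. C k) = ?S"
    by (rule clopen_cover_of_punctured_space[OF S \<B> assms(5)]) (rule that)
  have "openin S (\<Union>k\<in>K. C k)"
    using C(1) unfolding clopenin_def by blast
  then have "openin S ?S" unfolding C(2) .
  then have "card_of (topspace Y) \<le>o card_of (Pow (Pow K))"
    by (rule card_of_stone_cech_le[OF \<B>(1) ordIso_imp_ordLeq[OF \<B>(2)] _ assms(6)])
  then have "card_of (topspace Y - e ` ?S) \<le>o card_of (Pow (Pow K))"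
    by (rule ordLeq_transitive[OF card_of_mono1[OF Diff_subset]])
  moreover have "card_of (Pow (Pow K)) \<le>o card_of (topspace Y - e ` ?S)"
    by (rule card_of_remainder_ge[OF assms(1,3,5) C assms(6)])
  ultimately show ?thesis by (simp add: ordIso_iff_ordLeq)
qed

end
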